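(* Let $G=(V,E,T,c)$ be a planar $k$-terminal network with $\gamma=\gamma(G)$, with faces $f_1,\dots,f_\gamma$ and numbers $k_1,\dots,k_\gamma$ as in the context. Then $$|\mathcal{T}_e(G)|\le 2^{2\gamma}\prod_{i=1}^{\gamma}k_i^2\le (2k/\gamma)^{2\gamma}.$$
   Context: A $k$-terminal network $G=(V,E,T,c)$ is a finite connected undirected graph $(V,E)$ with edge weights $c:E\to\mathbb{R}_{>0}$ and a set $T\subseteq V$ of $|T|=k$ terminals. For $W\subseteq V$ let $\delta(W)$ be the set of edges with exactly one endpoint in $W$. For $S\subset T$ with $S\neq\emptyset,T$, the minimum-weight cutset $\delta(W)$ over all $W$ with $W\cap T\in\{S,T\setminus S\}$ is assumed unique and denoted $E_S$. $CC(F)$ denotes the set of connected components of $(V,E\setminus F)$, and $\mathcal{T}_e(G)=\{S\subset T:\ S\neq\emptyset,T,\ |CC(E_S)|=2\}$. $G$ is planar with a fixed embedding; $\gamma(G)$ is the minimum number of faces whose boundaries together contain all terminals. Fix faces $f_1,\dots,f_\gamma$ achieving this, partition $T=T_1\sqcup\dots\sqcup T_\gamma$ with every terminal of $T_i$ on the boundary of $f_i$ (ties broken arbitrarily), and let $k_i=|T_i|$, so $\sum_i k_i=k$. *)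

theory Defs
  imports Complex_Main
begin

text \<open>A planar k-terminal network with a fixed embedding, given as a combinatorial map
  (rotation system).  Vertices of type 'v, darts (half-edges) of type 'd.
  Each edge consists of two darts d and alpha d; tl d is the vertex at which dart d starts;
  sigma is the rotation (the cyclic order of darts around each vertex).
  Faces are the orbits of sigma o alpha.  The embedding is planar (genus 0) iff
  |V| - |E| + |F| = 2 (Euler's formula), the graph being connected.\<close>

record ('v, 'd) network =
  verts :: "'v set"
  darts :: "'d set"
  alpha :: "'d \<Rightarrow> 'd"
  sigma :: "'d \<Rightarrow> 'd"
  tl :: "'d \<Rightarrow> 'v"
  terms :: "'v set"
  wt :: "'d set \<Rightarrow> real"

definition edge_of :: "('v, 'd) network \<Rightarrow> 'd \<Rightarrow> 'd set" where
  "edge_of G d = {d, alpha G d}"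

definition edges :: "('v, 'd) network \<Rightarrow> 'd set set" where
  "edges G = edge_of G ` darts G"

definition comb_map :: "('v, 'd) network \<Rightarrow> bool" where
  "comb_map G \<longleftrightarrow> finite (verts G) \<and> finite (darts G)
     \<and> (\<forall>d\<in>darts G. alpha G d \<in> darts G \<and> alpha G d \<noteq> d \<and> alpha G (alpha G d) = d)
     \<and> bij_betw (sigma G) (darts G) (darts G)
     \<and> (\<forall>d\<in>darts G. tl G d \<in> verts G \<and> tl G (sigma G d) = tl G d)
     \<and> (\<forall>d\<in>darts G. \<forall>d'\<in>darts G. tl G d = tl G d' \<longrightarrow> (\<exists>n. (sigma G ^^ n) d = d'))"

definition face_of :: "('v, 'd) network \<Rightarrow> 'd \<Rightarrow> 'd set" where
  "face_of G d = {((sigma G \<circ> alpha G) ^^ n) d | n. True}"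

definition faces :: "('v, 'd) network \<Rightarrow> 'd set set" where
  "faces G = face_of G ` darts G"

definition face_boundary :: "('v, 'd) network \<Rightarrow> 'd set \<Rightarrow> 'v set" where
  "face_boundary G f = tl G ` f"

definition adj_without :: "('v, 'd) network \<Rightarrow> 'd set set \<Rightarrow> 'v \<Rightarrow> 'v \<Rightarrow> bool" where
  "adj_without G F u v \<longleftrightarrow>
     (\<exists>d\<in>darts G. edge_of G d \<notin> F \<and> tl G d = u \<and> tl G (alpha G d) = v)"

definition reach_without :: "('v, 'd) network \<Rightarrow> 'd set set \<Rightarrow> 'v \<Rightarrow> 'v \<Rightarrow> bool" where
  "reach_without G F = (adj_without G F)\<^sup>*\<^sup>*"

definition CC :: "('v, 'd) network \<Rightarrow> 'd set set \<Rightarrow> 'v set set" where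
  "CC G F = {{v \<in> verts G. reach_without G F u v} | u. u \<in> verts G}"

definition connected_net :: "('v, 'd) network \<Rightarrow> bool" where
  "connected_net G \<longleftrightarrow> (\<forall>u\<in>verts G. \<forall>v\<in>verts G. reach_without G {} u v)"

definition planar_net :: "('v, 'd) network \<Rightarrow> bool" where
  "planar_net G \<longleftrightarrow> comb_map G \<and> connected_net G
     \<and> int (card (verts G)) - int (card (edges G)) + int (card (faces G)) = 2"

definition terminal_network :: "('v, 'd) network \<Rightarrow> bool" where
  "terminal_network G \<longleftrightarrow> planar_net G \<and> terms G \<subseteq> verts G
     \<and> (\<forall>e\<in>edges G. wt G e > 0)"

definition cut :: "('v, 'd) network \<Rightarrow> 'v set \<Rightarrow> 'd set set" where
  "cut G W = {edge_of G d | d. d \<in> darts G \<and> tl G d \<in> W \<and> tl G (alpha G d) \<notin> W}"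

definition cut_weight :: "('v, 'd) network \<Rightarrow> 'd set set \<Rightarrow> real" where
  "cut_weight G F = (\<Sum>e\<in>F. wt G e)"

definition separates :: "('v, 'd) network \<Rightarrow> 'v set \<Rightarrow> 'v set \<Rightarrow> bool" where
  "separates G S W \<longleftrightarrow> W \<subseteq> verts G \<and> (W \<inter> terms G = S \<or> W \<inter> terms G = terms G - S)"

definition is_min_cutset :: "('v, 'd) network \<Rightarrow> 'v set \<Rightarrow> 'd set set \<Rightarrow> bool" where
  "is_min_cutset G S F \<longleftrightarrow>
     (\<exists>W. separates G S W \<and> F = cut G W)
     \<and> (\<forall>W. separates G S W \<longrightarrow> cut_weight G F \<le> cut_weight G (cut G W))"

definition proper_terminal_subset :: "('v, 'd) network \<Rightarrow> 'v set \<Rightarrow> bool" where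
  "proper_terminal_subset G S \<longleftrightarrow> S \<subseteq> terms G \<and> S \<noteq> {} \<and> S \<noteq> terms G"

definition unique_min_cuts :: "('v, 'd) network \<Rightarrow> bool" where
  "unique_min_cuts G \<longleftrightarrow> (\<forall>S. proper_terminal_subset G S \<longrightarrow> (\<exists>!F. is_min_cutset G S F))"

definition E_S :: "('v, 'd) network \<Rightarrow> 'v set \<Rightarrow> 'd set set" where
  "E_S G S = (THE F. is_min_cutset G S F)"

definition T_e :: "('v, 'd) network \<Rightarrow> 'v set set" where
  "T_e G = {S. proper_terminal_subset G S \<and> card (CC G (E_S G S)) = 2}"

definition face_cover :: "('v, 'd) network \<Rightarrow> nat \<Rightarrow> (nat \<Rightarrow> 'd set) \<Rightarrow> bool" where
  "face_cover G m f \<longleftrightarrow> (\<forall>i<m. f i \<in> faces G) \<and> terms G \<subseteq> (\<Union>i<m. face_boundary G (f i))"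

definition gamma :: "('v, 'd) network \<Rightarrow> nat" where
  "gamma G = (LEAST m. \<exists>f. face_cover G m f)"

end

theory Submission
  imports Defs "HOL-Analysis.Convex" "HOL-Library.FuncSet"
begin

text \<open>If \<^term>\<open>E_S G S\<close> has two components, it is a bond, i.e. a simple cycle of the dual graph, so it
  crosses each face at most once. Going around a face, one therefore enters and leaves a side of
  the cut at most once, and the terminals of that side on the face form a cyclic interval; there
  are few of these. Simplicity of the dual cycle is derived from Euler's formula without any
  topology: over the field with two elements a dimension count shows that every edge set that is
  even on each face is a cut.\<close>

text \<open>What replaces a separating closed curve is the minimality of bonds: a nonempty cut
  inside a bond is the whole bond, so a dual cycle using only one of two exits from a face cannot
  lie in it. The product arises because a terminal set is determined by its traces on the parts
  \<open>Tp i\<close>. On one face, an ordered pair of end points accounts for the square of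
  \<open>card (Tp i)\<close>, and the choice between interval and complement for a factor 2, later
  relaxed to 4 to match the stated power of 2. Minimality of \<open>gamma G\<close> guarantees that
  no part is empty; an empty part would make the bound zero.\<close>

section \<open>Parity of symmetric differences, changes along a sequence, orbits of maps on finite
  sets\<close>

lemma odd_card_sym_diff:
  assumes "finite A" "finite B"
  shows "odd (card (sym_diff A B)) \<longleftrightarrow> odd (card A) \<noteq> odd (card B)"
proof -
  have 1: "card (sym_diff A B) = card (A - B) + card (B - A)"
    using assms by (intro card_Un_disjoint) auto
  have 2: "card A = card (A - B) + card (A \<inter> B)"
    using assms card_Diff_subset_Int[of A B] card_mono[of A "A \<inter> B"] by simp
  have 3: "card B = card (B - A) + card (A \<inter> B)"
    using assms card_Diff_subset_Int[of B A] card_mono[of B "A \<inter> B"] by (simp add: Int_commute)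
  show ?thesis unfolding 1 2 3 by (auto simp del: card_0_eq)
qed

text \<open>Discrete intermediate value principle. Applied to membership in a side of a cut, or to
  its negation, it locates where a walk around a face crosses the cut.\<close>

lemma ex_descent:
  fixes x y :: nat
  assumes "x < y" "P x" "\<not> P y"
  obtains n where "x \<le> n" "n < y" "P n" "\<not> P (Suc n)"
proof -
  have "\<exists>n. x \<le> n \<and> n < y \<and> P n \<and> \<not> P (Suc n)"
  proof (rule ccontr)
    assume neg: "\<nexists>n. x \<le> n \<and> n < y \<and> P n \<and> \<not> P (Suc n)"
    have "m \<le> y \<longrightarrow> P m" if "x \<le> m" for m
      using that by (induction rule: dec_induct) (use assms neg in auto)
    then show False using assms by auto
  qed
  then show ?thesis using that by blast
qed

text \<open>Finiteness forces a repetition, and injectivity pulls it back to \<open>x\<close>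
  itself, so the orbit is a pure cycle. Orbits are given as sets over all exponents; the least
  period lists them without repetition.\<close>

lemma funpow_period:
  fixes h :: "'a \<Rightarrow> 'a"
  assumes fin: "finite A" and bij: "bij_betw h A A" and x: "x \<in> A"
  obtains p where "p > 0" "(h ^^ p) x = x" "inj_on (\<lambda>n. (h ^^ n) x) {..<p}"
    "{(h ^^ n) x |n. True} = (\<lambda>n. (h ^^ n) x) ` {..<p}"
proof -
  have mem: "(h ^^ n) x \<in> A" for n
    using bij x by (induction n) (auto simp: bij_betw_def)
  have bijn: "bij_betw (h ^^ n) A A" for n
    using bij by (rule bij_betw_funpow)
  have returns: "(h ^^ (n - m)) x = x" if "m < n" "(h ^^ m) x = (h ^^ n) x" for m n
  proof -
    have "(h ^^ n) x = (h ^^ m) ((h ^^ (n - m)) x)"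
      using that(1) by (metis add_diff_inverse_nat comp_apply funpow_add less_imp_not_less)
    then have "(h ^^ m) x = (h ^^ m) ((h ^^ (n - m)) x)" using that by simp
    then show ?thesis using bijn[of m] mem[of "n - m"] x
      by (metis bij_betw_imp_inj_on inj_on_eq_iff)
  qed
  have "\<not> inj (\<lambda>n. (h ^^ n) x)"
  proof
    assume "inj (\<lambda>n. (h ^^ n) x)"
    then have "infinite (range (\<lambda>n. (h ^^ n) x))" by (simp add: finite_image_iff)
    moreover have "range (\<lambda>n. (h ^^ n) x) \<subseteq> A" using mem by auto
    ultimately show False using fin finite_subset by blast
  qed
  then obtain m n where "m < n" "(h ^^ m) x = (h ^^ n) x"
    unfolding inj_def by (metis nat_neq_iff)
  then have ex: "\<exists>p>0. (h ^^ p) x = x" using returns[of m n] by (intro exI[of _ "n - m"]) auto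
  define p where "p = (LEAST p. p > 0 \<and> (h ^^ p) x = x)"
  have p: "p > 0" "(h ^^ p) x = x"
    using LeastI_ex[OF ex] by (auto simp: p_def)
  have least: "p \<le> q" if "q > 0" "(h ^^ q) x = x" for q
    unfolding p_def using that by (intro Least_le) auto
  have "inj_on (\<lambda>n. (h ^^ n) x) {..<p}"
  proof (rule linorder_inj_onI)
    fix m n assume "m < n" "m \<in> {..<p}" "n \<in> {..<p}"
    then show "(h ^^ m) x \<noteq> (h ^^ n) x"
      using returns[of m n] least[of "n - m"] by auto
  qed auto
  moreover have "{(h ^^ n) x |n. True} = (\<lambda>n. (h ^^ n) x) ` {..<p}"
  proof -
    have "(h ^^ n) x = (h ^^ (n mod p)) x" "n mod p < p" for n
      using funpow_mod_eq[OF p(2), of n] p(1) by auto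
    then show ?thesis by auto
  qed
  ultimately show ?thesis using p that by blast
qed

lemma ex_bij_invariant_subset:
  assumes "finite C" "C \<noteq> {}" "h ` C \<subseteq> C"
  obtains A where "A \<subseteq> C" "A \<noteq> {}" "bij_betw h A A"
proof -
  let ?P = "\<lambda>A. A \<subseteq> C \<and> A \<noteq> {} \<and> h ` A \<subseteq> A"
  define A where "A = arg_min card ?P"
  have "?P A" and min: "\<And>B. ?P B \<Longrightarrow> card A \<le> card B"
    using arg_min_nat_lemma[of ?P C card] assms unfolding A_def by auto
  have fA: "finite A" using \<open>?P A\<close> assms finite_subset by blast
  have "card A \<le> card (h ` A)"
    using \<open>?P A\<close> by (intro min) blast
  then have "h ` A = A"
    using \<open>?P A\<close> fA by (meson card_seteq)
  then have "bij_betw h A A"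
    using fA by (simp add: bij_betw_def eq_card_imp_inj_on)
  then show ?thesis using that \<open>?P A\<close> by blast
qed

section \<open>Darts, edges and faces of a combinatorial map\<close>

locale combinatorial_map =
  fixes G :: "('v, 'd) network"
  assumes comb_map: "comb_map G"
begin

text \<open>The head of \<open>d\<close> is the tail of \<open>phi d\<close>, so iterating
  \<open>phi\<close> walks along the boundary of a face.\<close>

definition phi :: "'d \<Rightarrow> 'd" where
  "phi = sigma G \<circ> alpha G"

lemma face_of_eq_orbit: "face_of G d = {(phi ^^ n) d |n. True}"
  by (simp add: face_of_def phi_def)

lemma finite_verts: "finite (verts G)" and finite_darts: "finite (darts G)"
  using comb_map by (auto simp: comb_map_def)

lemma finite_edges: "finite (edges G)" and finite_faces: "finite (faces G)"
  by (auto simp: edges_def faces_def finite_darts)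

lemma alpha_simps [simp]:
  assumes "d \<in> darts G"
  shows "alpha G d \<in> darts G" "alpha G d \<noteq> d" "alpha G (alpha G d) = d"
  using comb_map assms by (auto simp: comb_map_def)

lemma sigma_in_darts [simp]: "d \<in> darts G \<Longrightarrow> sigma G d \<in> darts G"
  using comb_map by (auto simp: comb_map_def bij_betw_def)

lemma tl_simps [simp]:
  assumes "d \<in> darts G"
  shows "tl G d \<in> verts G" "tl G (sigma G d) = tl G d"
  using comb_map assms by (auto simp: comb_map_def)

lemma same_tl_sigma_orbit:
  "d \<in> darts G \<Longrightarrow> d' \<in> darts G \<Longrightarrow> tl G d = tl G d' \<Longrightarrow> \<exists>n. (sigma G ^^ n) d = d'"
  using comb_map by (auto simp: comb_map_def)

lemma bij_alpha: "bij_betw (alpha G) (darts G) (darts G)"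
  by (rule bij_betwI[where g = "alpha G"]) auto

lemma bij_phi: "bij_betw phi (darts G) (darts G)"
  using bij_betw_trans[OF bij_alpha] comb_map by (auto simp: comb_map_def phi_def)

lemma phi_simps [simp]:
  assumes "d \<in> darts G"
  shows "phi d \<in> darts G" "tl G (phi d) = tl G (alpha G d)" "phi (alpha G d) = sigma G d"
  using assms by (auto simp: phi_def)

lemma edge_of_alpha [simp]: "d \<in> darts G \<Longrightarrow> edge_of G (alpha G d) = edge_of G d"
  by (auto simp: edge_of_def)

lemma edge_of_eq_iff:
  "d \<in> darts G \<Longrightarrow> e \<in> darts G \<Longrightarrow> edge_of G d = edge_of G e \<longleftrightarrow> d = e \<or> d = alpha G e"
  by (auto simp: edge_of_def doubleton_eq_iff)

lemma face_of_subset: "d \<in> darts G \<Longrightarrow> face_of G d \<subseteq> darts G"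
proof
  fix e assume d: "d \<in> darts G" "e \<in> face_of G d"
  then obtain n where e: "e = (phi ^^ n) d" by (auto simp: face_of_eq_orbit)
  show "e \<in> darts G" unfolding e using d(1) by (induction n) auto
qed

lemma face_subset: "g \<in> faces G \<Longrightarrow> g \<subseteq> darts G"
  using face_of_subset by (auto simp: faces_def)

lemma finite_face: "g \<in> faces G \<Longrightarrow> finite g"
  using face_subset finite_darts finite_subset by blast

lemma face_of_self [simp]: "d \<in> face_of G d"
  by (auto simp: face_of_eq_orbit intro: exI[of _ 0])

lemma face_of_in_faces [simp]: "d \<in> darts G \<Longrightarrow> face_of G d \<in> faces G"
  by (auto simp: faces_def)

lemma face_of_phi: "d \<in> darts G \<Longrightarrow> face_of G (phi d) = face_of G d"
proof
  assume d: "d \<in> darts G"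
  have "(phi ^^ n) (phi d) = (phi ^^ Suc n) d" for n
    by (simp only: funpow_Suc_right comp_apply)
  then show "face_of G (phi d) \<subseteq> face_of G d"
    unfolding face_of_eq_orbit by blast
  obtain p where p: "p > 0" "(phi ^^ p) d = d"
    using funpow_period[OF finite_darts bij_phi d] by metis
  show "face_of G d \<subseteq> face_of G (phi d)"
  proof
    fix e assume "e \<in> face_of G d"
    then obtain n where "e = (phi ^^ n) d" by (auto simp: face_of_eq_orbit)
    also have "\<dots> = (phi ^^ n) ((phi ^^ p) d)" using p by simp
    also have "\<dots> = (phi ^^ (n + p)) d" by (simp add: funpow_add)
    also have "n + p = Suc (n + (p - 1))" using p(1) by simp
    also have "(phi ^^ \<dots>) d = (phi ^^ (n + (p - 1))) (phi d)"
      by (simp only: funpow_Suc_right comp_apply)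
    finally show "e \<in> face_of G (phi d)" unfolding face_of_eq_orbit by blast
  qed
qed

lemma face_of_eq:
  assumes "g \<in> faces G" "d \<in> g"
  shows "face_of G d = g"
proof -
  obtain e where e: "e \<in> darts G" "g = face_of G e" using assms by (auto simp: faces_def)
  then obtain n where n: "d = (phi ^^ n) e" using assms by (auto simp: face_of_eq_orbit)
  have "(phi ^^ n) e \<in> darts G \<and> face_of G ((phi ^^ n) e) = face_of G e"
  proof (induction n)
    case (Suc n)
    then show ?case using face_of_phi[of "(phi ^^ n) e"] by auto
  qed (use e in auto)
  then show ?thesis using n e by simp
qed

lemma mem_face_iff: "g \<in> faces G \<Longrightarrow> d \<in> darts G \<Longrightarrow> d \<in> g \<longleftrightarrow> face_of G d = g"
  using face_of_eq by auto

lemma phi_mem_face_iff: "g \<in> faces G \<Longrightarrow> d \<in> darts G \<Longrightarrow> phi d \<in> g \<longleftrightarrow> d \<in> g"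
  using face_of_phi[of d] by (simp add: mem_face_iff)

lemma bij_phi_face:
  assumes g: "g \<in> faces G"
  shows "bij_betw phi g g"
proof -
  have inj: "inj_on phi g"
    using bij_phi face_subset[OF g] by (meson bij_betw_imp_inj_on inj_on_subset)
  have "phi ` g \<subseteq> g" using phi_mem_face_iff[OF g] face_subset[OF g] by blast
  then have "phi ` g = g" using inj finite_face[OF g] by (intro endo_inj_surj) auto
  then show ?thesis using inj by (simp add: bij_betw_def)
qed

section \<open>Edge sets modulo 2: the face boundary map and cuts\<close>

definition odd_on :: "'d set set \<Rightarrow> 'd set \<Rightarrow> bool" where
  "odd_on K g \<longleftrightarrow> odd (card {d \<in> g. edge_of G d \<in> K})"

text \<open>The kernel of the face boundary map over the field with two elements; seen in the dual
  graph, its cycle space.\<close>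

definition cocycles :: "'d set set set" where
  "cocycles = {K. K \<subseteq> edges G \<and> (\<forall>g\<in>faces G. \<not> odd_on K g)}"

lemma odd_on_sym_diff:
  assumes "g \<in> faces G"
  shows "odd_on (sym_diff K L) g \<longleftrightarrow> odd_on K g \<noteq> odd_on L g"
proof -
  have "{d \<in> g. edge_of G d \<in> sym_diff K L}
      = sym_diff {d \<in> g. edge_of G d \<in> K} {d \<in> g. edge_of G d \<in> L}" by auto
  then show ?thesis
    using odd_card_sym_diff[of "{d \<in> g. edge_of G d \<in> K}" "{d \<in> g. edge_of G d \<in> L}"]
      finite_face[OF assms] by (simp add: odd_on_def)
qed

text \<open>Parity counts darts, not edges: an edge with the same face on both sides contributes
  twice and cancels, hence the exclusive or.\<close>

lemma odd_on_edge:
  assumes g: "g \<in> faces G" and d: "d \<in> darts G"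
  shows "odd_on {edge_of G d} g \<longleftrightarrow> (d \<in> g) \<noteq> (alpha G d \<in> g)"
proof -
  have "{e \<in> g. edge_of G e \<in> {edge_of G d}} = {e \<in> {d, alpha G d}. e \<in> g}"
    using face_subset[OF g] d by (auto simp: edge_of_eq_iff)
  moreover have "card {e \<in> {d, alpha G d}. e \<in> g} = (if d \<in> g then 1 else 0) + (if alpha G d \<in> g then 1 else 0)"
  proof -
    have "{e \<in> {d, alpha G d}. e \<in> g} = (if d \<in> g then {d} else {}) \<union> (if alpha G d \<in> g then {alpha G d} else {})"
      by auto
    then show ?thesis using d by auto
  qed
  ultimately show ?thesis by (simp add: odd_on_def)
qed

lemma edge_of_in_cut_iff:
  assumes "d \<in> darts G"
  shows "edge_of G d \<in> cut G W \<longleftrightarrow> (tl G d \<in> W) \<noteq> (tl G (alpha G d) \<in> W)"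
proof
  assume "edge_of G d \<in> cut G W"
  then obtain e where "e \<in> darts G" "edge_of G d = edge_of G e" "tl G e \<in> W" "tl G (alpha G e) \<notin> W"
    by (auto simp: cut_def)
  then show "(tl G d \<in> W) \<noteq> (tl G (alpha G d) \<in> W)"
    using assms by (auto simp: edge_of_eq_iff)
next
  assume *: "(tl G d \<in> W) \<noteq> (tl G (alpha G d) \<in> W)"
  show "edge_of G d \<in> cut G W"
  proof (cases "tl G d \<in> W")
    case True
    then show ?thesis using * assms by (auto simp: cut_def)
  next
    case False
    then have "alpha G d \<in> darts G \<and> tl G (alpha G d) \<in> W \<and> tl G (alpha G (alpha G d)) \<notin> W"
      using * assms by auto
    then show ?thesis using assms by (auto simp: cut_def intro!: exI[of _ "alpha G d"])
  qed
qed

lemma cut_subset_edges: "cut G W \<subseteq> edges G"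
  by (auto simp: cut_def edges_def)

lemma cut_Compl: "cut G (verts G - W) = cut G W"
proof -
  have "edge_of G d \<in> cut G (verts G - W) \<longleftrightarrow> edge_of G d \<in> cut G W" if "d \<in> darts G" for d
    using that by (auto simp: edge_of_in_cut_iff)
  then show ?thesis
    using cut_subset_edges[of W] cut_subset_edges[of "verts G - W"] unfolding edges_def by blast
qed

text \<open>Tails and heads of the darts of a face are matched by the face permutation, so a face
  has as many darts leaving \<^term>\<open>W\<close> as darts entering it.\<close>

lemma cut_in_cocycles: "cut G W \<in> cocycles"
proof -
  have "\<not> odd_on (cut G W) g" if g: "g \<in> faces G" for g
  proof -
    let ?A = "{d \<in> g. tl G d \<in> W}" and ?B = "{d \<in> g. tl G (alpha G d) \<in> W}"
    have "phi ` ?B = ?A"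
    proof
      show "phi ` ?B \<subseteq> ?A"
        using phi_mem_face_iff[OF g] face_subset[OF g] by auto
      show "?A \<subseteq> phi ` ?B"
      proof
        fix d assume d: "d \<in> ?A"
        then obtain e where e: "e \<in> g" "d = phi e"
          using bij_phi_face[OF g] unfolding bij_betw_def by blast
        then show "d \<in> phi ` ?B" using d face_subset[OF g] by auto
      qed
    qed
    moreover have "inj_on phi ?B"
      using bij_phi_face[OF g] by (auto simp: bij_betw_def inj_on_def)
    ultimately have "card ?A = card ?B" using card_image[of phi ?B] by simp
    moreover have "{d \<in> g. edge_of G d \<in> cut G W} = sym_diff ?A ?B"
      using edge_of_in_cut_iff[OF subsetD[OF face_subset[OF g]]] by auto
    ultimately show ?thesis
      using odd_card_sym_diff[of ?A ?B] finite_face[OF g] by (simp add: odd_on_def)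
  qed
  then show ?thesis using cut_subset_edges by (auto simp: cocycles_def)
qed

end

section \<open>Connectedness, Euler's formula and the identification of cocycles with cuts\<close>

locale planar_map = combinatorial_map G for G :: "('v, 'd) network" +
  assumes planar: "planar_net G"
begin

lemma connected: "u \<in> verts G \<Longrightarrow> v \<in> verts G \<Longrightarrow> reach_without G {} u v"
  using planar by (auto simp: planar_net_def connected_net_def)

text \<open>The permutations \<open>alpha G\<close> and \<open>phi\<close> act transitively on
  darts: \<open>sigma G\<close> is \<open>phi\<close> after \<open>alpha G\<close>, its iterates
  reach all darts at a vertex, and connectedness leads to the other vertices. In dual terms,
  \<open>alpha G\<close> crosses an edge and \<open>phi\<close> stays in the face.\<close>

lemma dart_induct [consumes 2, case_names base alpha phi]:
  assumes "d \<in> darts G" "d0 \<in> darts G" "P d0"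
    and alpha: "\<And>d. d \<in> darts G \<Longrightarrow> P d \<Longrightarrow> P (alpha G d)"
    and phi: "\<And>d. d \<in> darts G \<Longrightarrow> P d \<Longrightarrow> P (phi d)"
  shows "P d"
proof -
  have sig: "P (sigma G e)" if "e \<in> darts G" "P e" for e
    using phi[of "alpha G e"] alpha[of e] that by simp
  have sign: "(sigma G ^^ n) e \<in> darts G \<and> P ((sigma G ^^ n) e)" if "e \<in> darts G" "P e" for e n
    by (induction n) (use that sig in auto)
  have same: "P e'" if "e \<in> darts G" "e' \<in> darts G" "tl G e = tl G e'" "P e" for e e'
    using same_tl_sigma_orbit[OF that(1-3)] sign that by metis
  have "reach_without G {} (tl G d0) (tl G d)" using assms connected by simp
  then have "(adj_without G {})\<^sup>*\<^sup>* (tl G d0) (tl G d)" by (simp add: reach_without_def)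
  then have "\<exists>e\<in>darts G. tl G e = tl G d \<and> P e"
  proof (induction)
    case base
    then show ?case using assms by blast
  next
    case (step v w)
    then obtain e where e: "e \<in> darts G" "tl G e = v" "P e" by blast
    obtain e' where e': "e' \<in> darts G" "tl G e' = v" "tl G (alpha G e') = w"
      using step(2) by (auto simp: adj_without_def)
    then have "P e'" using same e by metis
    then show ?case using e' alpha alpha_simps(1) by blast
  qed
  then show ?thesis using same assms(1) by blast
qed

text \<open>Faces are orbits of darts, so a map without darts has no face; Euler's formula would
  then demand two vertices, against connectedness.\<close>

lemma darts_nonempty: "darts G \<noteq> {}"
proof
  assume e: "darts G = {}"
  then have "edges G = {}" "faces G = {}" by (auto simp: edges_def faces_def)
  then have "card (verts G) = 2" using planar by (simp add: planar_net_def)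
  then obtain u v where uv: "verts G = {u, v}" "u \<noteq> v" by (auto simp: card_2_iff)
  then have "reach_without G {} u v" using connected by auto
  then have "(adj_without G {})\<^sup>*\<^sup>* u v" by (simp add: reach_without_def)
  then show False using uv(2) e by (auto simp: adj_without_def elim: converse_rtranclpE)
qed

text \<open>A set and its complement have the same cut; keeping \<open>v0\<close> outside selects
  one of the two. Along a walk from \<open>v0\<close>, membership flips exactly at the cut edges, so
  the cut determines the set.\<close>

lemma cut_inj:
  assumes "v0 \<in> verts G"
  shows "inj_on (cut G) (Pow (verts G - {v0}))"
proof (rule inj_onI)
  fix X Y assume X: "X \<in> Pow (verts G - {v0})" and Y: "Y \<in> Pow (verts G - {v0})" and eq: "cut G X = cut G Y"
  have "v \<in> X \<longleftrightarrow> v \<in> Y" if "v \<in> verts G" for v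
  proof -
    have "reach_without G {} v0 v" using connected assms that by simp
    then have "(adj_without G {})\<^sup>*\<^sup>* v0 v" by (simp add: reach_without_def)
    then show ?thesis
    proof (induction)
      case base
      then show ?case using X Y by auto
    next
      case (step v w)
      then obtain e where "e \<in> darts G" "tl G e = v" "tl G (alpha G e) = w"
        by (auto simp: adj_without_def)
      then show ?case using step edge_of_in_cut_iff[of e X] edge_of_in_cut_iff[of e Y] eq by auto
    qed
  qed
  then show "X = Y" using X Y by blast
qed

text \<open>Connectedness of the dual graph, in the form that the face boundary map is onto once one
  face is disregarded.\<close>

lemma ex_edges_odd_on:
  assumes g0: "g0 \<in> faces G" and Y: "Y \<subseteq> faces G - {g0}"
  shows "\<exists>K\<subseteq>edges G. \<forall>g\<in>faces G - {g0}. odd_on K g \<longleftrightarrow> g \<in> Y"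
proof -
  obtain d0 where d0: "d0 \<in> darts G" "g0 = face_of G d0" using g0 by (auto simp: faces_def)
  \<comment> \<open>Here \<open>K\<close> is built from the edges crossed by a dual walk from
    \<open>g0\<close> to the face of \<open>d\<close>, taken modulo 2. Away from \<open>g0\<close>
    only the final face is odd; at the start \<open>K\<close> is empty.\<close>
  have single: "\<exists>K\<subseteq>edges G. \<forall>g\<in>faces G - {g0}. odd_on K g \<longleftrightarrow> d \<in> g" if "d \<in> darts G" for d
    using that d0(1)
  proof (induction rule: dart_induct)
    case base
    have "\<forall>g\<in>faces G - {g0}. odd_on {} g \<longleftrightarrow> d0 \<in> g"
      using face_of_eq d0 by (auto simp: odd_on_def)
    then show ?case by blast
  next
    case (alpha d)
    then obtain K where K: "K \<subseteq> edges G" "\<forall>g\<in>faces G - {g0}. odd_on K g \<longleftrightarrow> d \<in> g" by blast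
    have "\<forall>g\<in>faces G - {g0}. odd_on (sym_diff K {edge_of G d}) g \<longleftrightarrow> alpha G d \<in> g"
      using K(2) alpha(1) odd_on_sym_diff odd_on_edge by (metis DiffD1)
    moreover have "sym_diff K {edge_of G d} \<subseteq> edges G" using K alpha by (auto simp: edges_def)
    ultimately show ?case by blast
  next
    case (phi d)
    then show ?case using phi_mem_face_iff by auto
  qed
  have "finite Y" using Y finite_faces finite_subset by blast
  then show ?thesis using Y
  proof (induction Y)
    case empty
    then show ?case by (auto simp: odd_on_def intro!: exI[of _ "{}"])
  next
    case (insert h Y)
    then obtain K where K: "K \<subseteq> edges G" "\<forall>g\<in>faces G - {g0}. odd_on K g \<longleftrightarrow> g \<in> Y" by auto
    obtain d where d: "d \<in> darts G" "h = face_of G d" using insert by (auto simp: faces_def)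
    obtain L where L: "L \<subseteq> edges G" "\<forall>g\<in>faces G - {g0}. odd_on L g \<longleftrightarrow> d \<in> g"
      using single[OF d(1)] by blast
    have "\<forall>g\<in>faces G - {g0}. odd_on (sym_diff K L) g \<longleftrightarrow> g \<in> insert h Y"
      using K(2) L(2) odd_on_sym_diff mem_face_iff[OF _ d(1)] d(2) insert.hyps(2)
      by (metis DiffD1 insert_iff)
    moreover have "sym_diff K L \<subseteq> edges G" using K L by auto
    ultimately show ?case by blast
  qed
qed

text \<open>There are \<open>2 ^ (|V| - 1)\<close> cuts, and by Euler's formula at most that many elements in the kernel
  of the face boundary map over the field with two elements.\<close>

lemma cocycle_is_cut:
  assumes "K \<in> cocycles"
  obtains X where "X \<subseteq> verts G" "K = cut G X"
proof -
  obtain d0 where d0: "d0 \<in> darts G" using darts_nonempty by blast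
  define g0 where "g0 = face_of G d0"
  define v0 where "v0 = tl G d0"
  have g0: "g0 \<in> faces G" and v0: "v0 \<in> verts G" using d0 by (auto simp: g0_def v0_def)
  \<comment> \<open>\<open>s\<close> chooses one preimage for each set of faces. Adding a cocycle
    \<open>L\<close> to \<open>s Y\<close> loses nothing: the boundary returns \<open>Y\<close>, and
    cancelling \<open>s Y\<close> returns \<open>L\<close>. This is rank-nullity as a count.\<close>
  obtain s where s: "\<And>Y. Y \<subseteq> faces G - {g0} \<Longrightarrow> s Y \<subseteq> edges G \<and> (\<forall>g\<in>faces G - {g0}. odd_on (s Y) g \<longleftrightarrow> g \<in> Y)"
    using ex_edges_odd_on[OF g0] by metis
  let ?Y = "Pow (faces G - {g0})"
  have finc: "finite cocycles"
    by (rule finite_subset[of _ "Pow (edges G)"]) (auto simp: cocycles_def finite_edges)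
  have inj: "inj_on (\<lambda>(L, Y). sym_diff L (s Y)) (cocycles \<times> ?Y)"
  proof (rule inj_onI, clarify)
    fix L Y L' Y'
    assume L: "L \<in> cocycles" "L' \<in> cocycles" and Y: "Y \<subseteq> faces G - {g0}" "Y' \<subseteq> faces G - {g0}"
      and eq: "sym_diff L (s Y) = sym_diff L' (s Y')"
    have "g \<in> Z \<longleftrightarrow> odd_on (sym_diff M (s Z)) g"
      if "g \<in> faces G - {g0}" "M \<in> cocycles" "Z \<subseteq> faces G - {g0}" for g M Z
      using that s[of Z] odd_on_sym_diff[of g M "s Z"] by (auto simp: cocycles_def)
    then have "g \<in> Y \<longleftrightarrow> g \<in> Y'" if "g \<in> faces G - {g0}" for g
      using L Y eq that by metis
    then have "Y = Y'" using Y by blast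
    then show "L = L' \<and> Y = Y'" using eq by blast
  qed
  have "sym_diff L (s Y) \<in> Pow (edges G)" if "L \<in> cocycles" "Y \<in> ?Y" for L Y
    using s[of Y] that by (auto simp: cocycles_def)
  then have "(\<lambda>(L, Y). sym_diff L (s Y)) ` (cocycles \<times> ?Y) \<subseteq> Pow (edges G)"
    by (intro image_subsetI) (simp only: mem_Times_iff case_prod_beta)
  then have "card (cocycles \<times> ?Y) \<le> card (Pow (edges G))"
    using inj finite_edges by (intro card_inj_on_le) auto
  then have le: "card cocycles * 2 ^ (card (faces G) - 1) \<le> 2 ^ card (edges G)"
    using g0 finite_faces finite_edges by (simp add: card_cartesian_product card_Pow)
  have F: "card (faces G) \<ge> 1" and V: "card (verts G) \<ge> 1"
    using g0 v0 finite_faces finite_verts by (auto simp: Suc_le_eq card_gt_0_iff)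
  have "card (edges G) = (card (verts G) - 1) + (card (faces G) - 1)"
    using planar F V unfolding planar_net_def by linarith
  then have "card cocycles \<le> 2 ^ (card (verts G) - 1)"
    using le by (simp add: power_add)
  also have "\<dots> = card (cut G ` Pow (verts G - {v0}))"
    using card_image[OF cut_inj[OF v0]] v0 finite_verts by (simp add: card_Pow)
  finally have "card cocycles \<le> card (cut G ` Pow (verts G - {v0}))" .
  moreover have "cut G ` Pow (verts G - {v0}) \<subseteq> cocycles" using cut_in_cocycles by blast
  ultimately have "cut G ` Pow (verts G - {v0}) = cocycles"
    using finc by (intro card_seteq)
  then obtain X where "X \<in> Pow (verts G - {v0})" "K = cut G X" using assms by blast
  then show ?thesis using that[of X] by blast
qed

section \<open>Bonds: cuts both of whose sides stay connected, and how they cross a face\<close>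

definition bond_side :: "'v set \<Rightarrow> bool" where
  "bond_side W \<longleftrightarrow> W \<subseteq> verts G
    \<and> (\<forall>u\<in>W. \<forall>v\<in>W. reach_without G (cut G W) u v)
    \<and> (\<forall>u\<in>verts G - W. \<forall>v\<in>verts G - W. reach_without G (cut G W) u v)"

lemma bond_side_Compl: "bond_side W \<Longrightarrow> bond_side (verts G - W)"
  by (auto simp: bond_side_def cut_Compl)

lemma reach_without_mem_iff:
  assumes "reach_without G F u v" "cut G X \<subseteq> F"
  shows "u \<in> X \<longleftrightarrow> v \<in> X"
proof -
  have "(adj_without G F)\<^sup>*\<^sup>* u v" using assms by (simp add: reach_without_def)
  then show ?thesis
  proof (induction)
    case (step v w)
    then obtain e where e: "e \<in> darts G" "edge_of G e \<notin> F" "tl G e = v" "tl G (alpha G e) = w"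
      by (auto simp: adj_without_def)
    then have "edge_of G e \<notin> cut G X" using assms(2) by blast
    then show ?case using step e edge_of_in_cut_iff[of e X] by auto
  qed auto
qed

text \<open>A walk avoiding \<open>cut G W\<close> also avoids \<open>cut G X\<close>, so membership
  in \<open>X\<close> is constant on each side of \<open>W\<close>. As \<open>cut G X\<close> is
  nonempty, the two constants differ, and every edge between the sides is cut by
  \<open>X\<close>.\<close>

lemma cut_subset_bond:
  assumes W: "bond_side W" and sub: "cut G X \<subseteq> cut G W" and ne: "cut G X \<noteq> {}"
  shows "cut G X = cut G W"
proof -
  have 1: "u \<in> X \<longleftrightarrow> v \<in> X" if "u \<in> verts G" "v \<in> verts G" "u \<in> W \<longleftrightarrow> v \<in> W" for u v
    using reach_without_mem_iff[OF _ sub, of u v] that W by (cases "u \<in> W") (auto simp: bond_side_def)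
  obtain d where d: "d \<in> darts G" "edge_of G d \<in> cut G X" using ne by (auto simp: cut_def)
  have dX: "(tl G d \<in> X) \<noteq> (tl G (alpha G d) \<in> X)" and dW: "(tl G d \<in> W) \<noteq> (tl G (alpha G d) \<in> W)"
    using d sub edge_of_in_cut_iff[of d] by blast+
  have "edge_of G e \<in> cut G X" if e: "e \<in> darts G" "edge_of G e \<in> cut G W" for e
  proof -
    have "(tl G e \<in> W) \<noteq> (tl G (alpha G e) \<in> W)" using e edge_of_in_cut_iff by blast
    then have "(tl G e \<in> X) \<noteq> (tl G (alpha G e) \<in> X)"
      using dX dW 1[of "tl G e" "tl G d"] 1[of "tl G e" "tl G (alpha G d)"]
        1[of "tl G (alpha G e)" "tl G d"] 1[of "tl G (alpha G e)" "tl G (alpha G d)"] d e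
      by (metis alpha_simps(1) tl_simps(1))
    then show ?thesis using e edge_of_in_cut_iff by blast
  qed
  then have "cut G W \<subseteq> cut G X" by (auto simp: cut_def)
  then show ?thesis using sub by blast
qed

text \<open>Without an exit, the walk that enters \<open>W\<close> along \<open>d\<close> would stay
  there forever, yet it returns periodically to \<open>d\<close>, whose tail lies outside.\<close>

lemma ex_enter_leave_face:
  assumes g: "g \<in> faces G" and d: "d \<in> g" "tl G d \<notin> W" "tl G (alpha G d) \<in> W"
  shows "\<exists>e\<in>g. tl G e \<in> W \<and> tl G (alpha G e) \<notin> W"
proof (rule ccontr)
  assume neg: "\<not> ?thesis"
  have dd: "d \<in> darts G" using d face_subset[OF g] by blast
  obtain p where p: "p > 0" "(phi ^^ p) d = d"
    using funpow_period[OF finite_darts bij_phi dd] by metis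
  have "(phi ^^ Suc n) d \<in> g \<and> tl G ((phi ^^ Suc n) d) \<in> W" for n
  proof (induction n)
    case 0
    then show ?case using phi_mem_face_iff[OF g dd] d dd by simp
  next
    case (Suc n)
    let ?e = "(phi ^^ Suc n) d"
    have e: "?e \<in> darts G" "?e \<in> g" "tl G ?e \<in> W" using Suc face_subset[OF g] by blast+
    then have "tl G (alpha G ?e) \<in> W" using neg by blast
    then have "phi ?e \<in> g \<and> tl G (phi ?e) \<in> W" using e phi_mem_face_iff[OF g e(1)] by simp
    then show ?case by simp
  qed
  from this[of "p - 1"] show False using p d by simp
qed

text \<open>A bond is a simple cycle of the dual graph: following the cut edges from face to face, a
  closed dual walk that leaves each face through at most one dart is a cocycle inside the bond,
  hence it is the whole bond.\<close>

lemma bond_leaves_face_once: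
  assumes W: "bond_side W" and g: "g \<in> faces G"
    and d: "d \<in> g" "tl G d \<in> W" "tl G (alpha G d) \<notin> W"
    and e: "e \<in> g" "tl G e \<in> W" "tl G (alpha G e) \<notin> W"
  shows "d = e"
proof -
  define C where "C = {d \<in> darts G. tl G d \<in> W \<and> tl G (alpha G d) \<notin> W}"
  \<comment> \<open>\<open>h\<close> chooses one exit from \<open>W\<close> per face.
    \<open>N\<close> crosses the edge of \<open>d\<close> into the next face, which is thereby
    entered and so has an exit, and takes the chosen one. Since the choice depends only on the face,
    a set of values of \<open>N\<close> has at most one dart in each face.\<close>
  define h where "h = (\<lambda>g. SOME d. d \<in> g \<and> d \<in> C)"
  define N where "N = (\<lambda>d. h (face_of G (alpha G d)))"
  have alC: "alpha G d \<notin> C" if "d \<in> C" for d using that by (auto simp: C_def)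
  have N: "N d \<in> face_of G (alpha G d) \<and> N d \<in> C" if "d \<in> C" for d
  proof -
    have dd: "d \<in> darts G" "tl G d \<in> W" "tl G (alpha G d) \<notin> W" using that by (auto simp: C_def)
    have "\<exists>e\<in>face_of G (alpha G d). tl G e \<in> W \<and> tl G (alpha G e) \<notin> W"
      using dd by (intro ex_enter_leave_face[of _ "alpha G d"]) auto
    then have "\<exists>e. e \<in> face_of G (alpha G d) \<and> e \<in> C"
      using face_of_subset[of "alpha G d"] dd by (auto simp: C_def)
    then show ?thesis unfolding N_def h_def by (rule someI_ex)
  qed
  have finC: "finite C" using finite_darts by (auto simp: C_def)
  have "d \<in> C" using d face_subset[OF g] by (auto simp: C_def)
  have "e \<in> C" using e face_subset[OF g] by (auto simp: C_def)
  \<comment> \<open>\<open>A\<close> is a union of closed dual walks: every dart in it has a unique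
    predecessor under \<open>N\<close>.\<close>
  obtain A where A: "A \<subseteq> C" "A \<noteq> {}" "bij_betw N A A"
    using ex_bij_invariant_subset[of C N] finC \<open>d \<in> C\<close> N by blast
  have Ad: "A \<subseteq> darts G" using A by (auto simp: C_def)
  have faceN: "face_of G (N d) = face_of G (alpha G d)" if "d \<in> A" for d
    using N[of d] that A(1) Ad face_of_eq[of "face_of G (alpha G d)" "N d"]
    by (meson alpha_simps(1) face_of_in_faces subsetD)
  have edge_iff: "edge_of G x \<in> edge_of G ` A \<longleftrightarrow> x \<in> A \<or> alpha G x \<in> A" if "x \<in> darts G" for x
  proof -
    have "edge_of G x \<in> edge_of G ` A \<longleftrightarrow> (\<exists>a\<in>A. x = a \<or> x = alpha G a)"
      unfolding image_iff using that Ad by (intro bex_cong refl edge_of_eq_iff) auto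
    moreover have "x = alpha G a \<longleftrightarrow> alpha G x = a" if "a \<in> A" for a
      using that Ad \<open>x \<in> darts G\<close> by auto
    ultimately show ?thesis by auto
  qed
  have "\<not> odd_on (edge_of G ` A) k" if k: "k \<in> faces G" for k
  proof -
    have kd: "k \<subseteq> darts G" by (rule face_subset[OF k])
    have split: "{x \<in> k. edge_of G x \<in> edge_of G ` A} = (k \<inter> A) \<union> {x \<in> k. alpha G x \<in> A}"
      using edge_iff kd by blast
    have disj: "(k \<inter> A) \<inter> {x \<in> k. alpha G x \<in> A} = {}" using A alC by blast
    have c1: "card {x \<in> k. alpha G x \<in> A} = card {x \<in> A. alpha G x \<in> k}"
    proof (rule bij_betw_same_card[of "alpha G"], rule bij_betwI[where g = "alpha G"])
      show "alpha G \<in> {x \<in> k. alpha G x \<in> A} \<rightarrow> {x \<in> A. alpha G x \<in> k}" using kd by auto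
      show "alpha G \<in> {x \<in> A. alpha G x \<in> k} \<rightarrow> {x \<in> k. alpha G x \<in> A}" using Ad by auto
    qed (use kd Ad in auto)
    \<comment> \<open>Each arrival in \<open>k\<close> across the edge of \<open>x\<close> is
      followed by the departure \<open>N x\<close> from \<open>k\<close>, so arrivals and departures
      match in number and their total is even.\<close>
    have "N ` {x \<in> A. alpha G x \<in> k} = k \<inter> A"
    proof
      show "N ` {x \<in> A. alpha G x \<in> k} \<subseteq> k \<inter> A"
      proof clarify
        fix x assume x: "x \<in> A" "alpha G x \<in> k"
        then have "N x \<in> A" using A(3) by (auto simp: bij_betw_def)
        moreover have "N x \<in> k" using N[of x] x A(1) face_of_eq[OF k x(2)] by auto
        ultimately show "N x \<in> k \<inter> A" by blast
      qed
      show "k \<inter> A \<subseteq> N ` {x \<in> A. alpha G x \<in> k}"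
      proof
        fix y assume y: "y \<in> k \<inter> A"
        then obtain x where x: "x \<in> A" "y = N x" using A(3) by (auto simp: bij_betw_def)
        then have "face_of G (alpha G x) = k" using faceN[OF x(1)] face_of_eq[OF k, of y] y by simp
        then have "alpha G x \<in> k" by (metis face_of_self)
        then show "y \<in> N ` {x \<in> A. alpha G x \<in> k}" using x by blast
      qed
    qed
    moreover have "inj_on N {x \<in> A. alpha G x \<in> k}"
      using A(3) by (auto simp: bij_betw_def inj_on_def)
    ultimately have c2: "card {x \<in> A. alpha G x \<in> k} = card (k \<inter> A)"
      using card_image[of N "{x \<in> A. alpha G x \<in> k}"] by simp
    have "card {x \<in> k. edge_of G x \<in> edge_of G ` A} = card (k \<inter> A) + card (k \<inter> A)"
      unfolding split using c1 c2 disj finite_face[OF k] by (subst card_Un_disjoint) auto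
    then show ?thesis by (simp add: odd_on_def)
  qed
  then have "edge_of G ` A \<in> cocycles" using Ad by (auto simp: cocycles_def edges_def)
  then obtain X where "X \<subseteq> verts G" and X: "edge_of G ` A = cut G X" by (rule cocycle_is_cut)
  have "cut G X \<subseteq> cut G W" unfolding X[symmetric] using A(1) by (auto simp: cut_def C_def)
  moreover have "cut G X \<noteq> {}" using X A(2) by auto
  ultimately have "edge_of G ` A = cut G W" using cut_subset_bond[OF W] X by simp
  then have "edge_of G x \<in> edge_of G ` A" if "x \<in> C" for x
    using that by (auto simp: cut_def C_def)
  then have CA: "C \<subseteq> A" using edge_iff alC A(1) by (auto simp: C_def)
  \<comment> \<open>Every dart of \<open>A\<close> is a value of \<open>N\<close>, hence the chosen
    exit of its face. As \<open>A\<close> now contains all exits in \<open>C\<close>, no face has a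
    second one.\<close>
  have h: "x = h k" if x: "x \<in> A" "x \<in> k" and k: "k \<in> faces G" for x k
  proof -
    obtain y where y: "y \<in> A" "x = N y" using A(3) x by (auto simp: bij_betw_def)
    then have "face_of G (alpha G y) = k" using faceN[of y] face_of_eq[OF k x(2)] by simp
    then show ?thesis using y by (simp add: N_def)
  qed
  have "d \<in> A" "e \<in> A" using CA \<open>d \<in> C\<close> \<open>e \<in> C\<close> by auto
  then show ?thesis using h[OF _ d(1) g] h[OF _ e(1) g] by simp
qed

lemma bond_enters_face_once:
  assumes W: "bond_side W" and g: "g \<in> faces G"
    and d: "d \<in> g" "tl G d \<notin> W" "tl G (alpha G d) \<in> W"
    and e: "e \<in> g" "tl G e \<notin> W" "tl G (alpha G e) \<in> W"
  shows "d = e"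
proof -
  have "d \<in> darts G" "e \<in> darts G" using d e face_subset[OF g] by auto
  then show ?thesis
    using bond_leaves_face_once[OF bond_side_Compl[OF W] g d(1) _ _ e(1)] d e by simp
qed

text \<open>Cutting the face open at a dart turns cyclic intervals of terminals into intervals and
  complements of intervals, each given by its two end points.\<close>

lemma card_bond_traces:
  assumes g: "g \<in> faces G" and T: "T \<subseteq> face_boundary G g" "T \<noteq> {}"
  shows "card {T \<inter> W |W. bond_side W} \<le> 2 * card T ^ 2"
proof -
  obtain d0 where d0: "d0 \<in> darts G" "g = face_of G d0" using g by (auto simp: faces_def)
  obtain p where p: "p > 0" "inj_on (\<lambda>n. (phi ^^ n) d0) {..<p}" "g = (\<lambda>n. (phi ^^ n) d0) ` {..<p}"
    using funpow_period[OF finite_darts bij_phi d0(1)] d0(2) unfolding face_of_eq_orbit by metis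
  define w where "w = (\<lambda>n. (phi ^^ n) d0)"
  have wg: "w n \<in> g" if "n < p" for n using p(3) that by (auto simp: w_def)
  have wd: "w n \<in> darts G" for n
    using face_of_subset[OF d0(1)] by (auto simp: w_def face_of_eq_orbit)
  have wSuc: "tl G (alpha G (w n)) = tl G (w (Suc n))" for n
    using wd[of n] by (simp add: w_def)
  have winj: "m = n" if "w m = w n" "m < p" "n < p" for m n
    using inj_onD[OF p(2)] that by (auto simp: w_def)
  have "\<exists>n<p. tl G (w n) = t" if "t \<in> T" for t
    using that T p(3) by (force simp: face_boundary_def w_def)
  \<comment> \<open>A vertex may occur several times around a face; \<open>r\<close> fixes one
    position for each terminal.\<close>
  then obtain r where r: "\<And>t. t \<in> T \<Longrightarrow> r t < p \<and> tl G (w (r t)) = t" by metis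
  define I where "I = (\<lambda>(s, t). {u \<in> T. r s \<le> r u \<and> r u \<le> r t})"
  have finT: "finite T"
    using T(1) finite_face[OF g] by (auto simp: face_boundary_def intro: finite_subset)
  have "T \<inter> W \<in> I ` (T \<times> T) \<union> (\<lambda>x. T - I x) ` (T \<times> T)" if W: "bond_side W" for W
  proof -
    let ?P = "\<lambda>n. tl G (w n) \<in> W"
    have Pr: "?P (r t) \<longleftrightarrow> t \<in> W" if "t \<in> T" for t using r[OF that] by simp
    have desc: "m = n" if "m < p" "n < p" "?P m" "\<not> ?P (Suc m)" "?P n" "\<not> ?P (Suc n)" for m n
      using bond_leaves_face_once[OF W g wg _ _ wg, of m n] winj that by (simp add: wSuc)
    have asc: "m = n" if "m < p" "n < p" "\<not> ?P m" "?P (Suc m)" "\<not> ?P n" "?P (Suc n)" for m n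
      using bond_enters_face_once[OF W g wg _ _ wg, of m n] winj that by (simp add: wSuc)
    \<comment> \<open>The pattern in-out-in has a descent before an ascent, the pattern out-in-out
      an ascent before a descent. With one of each available, both orders cannot occur, so
      \<open>W\<close> or its complement has an interval as trace.\<close>
    have conv: "False" if asm: "x < y" "y < z" "z < p" "?P x" "\<not> ?P y" "?P z"
      "x' < y'" "y' < z'" "z' < p" "\<not> ?P x'" "?P y'" "\<not> ?P z'" for x y z x' y' z'
    proof -
      obtain a where a: "x \<le> a" "a < y" "?P a" "\<not> ?P (Suc a)"
        using ex_descent[of x y ?P] asm by blast
      obtain b where b: "y \<le> b" "b < z" "\<not> ?P b" "?P (Suc b)"
        using ex_descent[of y z "\<lambda>n. \<not> ?P n"] asm by blast
      obtain a' where a': "x' \<le> a'" "a' < y'" "\<not> ?P a'" "?P (Suc a')"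
        using ex_descent[of x' y' "\<lambda>n. \<not> ?P n"] asm by blast
      obtain b' where b': "y' \<le> b'" "b' < z'" "?P b'" "\<not> ?P (Suc b')"
        using ex_descent[of y' z' ?P] asm by blast
      have "a = b'" "b = a'" using a b a' b' desc[of a b'] asc[of b a'] asm by auto
      then show False using a b a' b' by linarith
    qed
    \<comment> \<open>The end points are the terminals of \<open>A\<close> with the smallest and the
      largest position.\<close>
    have interval: "A \<in> I ` (T \<times> T)"
      if A: "A \<subseteq> T" "A \<noteq> {}" and cv: "\<And>s u t. s \<in> A \<Longrightarrow> t \<in> A \<Longrightarrow> u \<in> T \<Longrightarrow> r s < r u \<Longrightarrow> r u < r t \<Longrightarrow> u \<in> A"
      for A
    proof -
      have finA: "finite A" using A finT finite_subset by blast
      obtain s where s: "s \<in> A" "\<And>u. u \<in> A \<Longrightarrow> r s \<le> r u"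
      proof -
        have "Min (r ` A) \<in> r ` A" using finA \<open>A \<noteq> {}\<close> by simp
        then obtain s where "s \<in> A" "r s = Min (r ` A)" by auto
        then show ?thesis using that[of s] finA by simp
      qed
      obtain t where t: "t \<in> A" "\<And>u. u \<in> A \<Longrightarrow> r u \<le> r t"
      proof -
        have "Max (r ` A) \<in> r ` A" using finA \<open>A \<noteq> {}\<close> by simp
        then obtain t where "t \<in> A" "r t = Max (r ` A)" by auto
        then show ?thesis using that[of t] finA by simp
      qed
      have rinj: "u = v" if "u \<in> T" "v \<in> T" "r u = r v" for u v using r that by metis
      have "A = I (s, t)"
      proof
        show "A \<subseteq> I (s, t)" using s t \<open>A \<subseteq> T\<close> by (auto simp: I_def)
        show "I (s, t) \<subseteq> A"
        proof
          fix u assume "u \<in> I (s, t)"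
          then have u: "u \<in> T" "r s \<le> r u" "r u \<le> r t" by (auto simp: I_def)
          then show "u \<in> A" using cv[of s t u] rinj[of u s] rinj[of u t] s(1) t(1) \<open>A \<subseteq> T\<close>
            by (metis le_neq_implies_less subsetD)
        qed
      qed
      then show ?thesis using s(1) t(1) \<open>A \<subseteq> T\<close> by blast
    qed
    \<comment> \<open>The empty trace has no end points in itself and is represented as the
      complement of the full interval, whose end points exist because \<open>T\<close> is
      nonempty.\<close>
    have full: "T \<in> I ` (T \<times> T)" using T(2) by (intro interval) auto
    consider "T \<inter> W = {}" | "T - W = {}" | "T \<inter> W \<noteq> {}" "T - W \<noteq> {}" by blast
    then show ?thesis
    proof cases
      case 1
      then have "T \<inter> W = T - T" by blast
      then show ?thesis using full by blast
    next
      case 2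
      then have "T \<inter> W = T" by blast
      then show ?thesis using full by simp
    next
      case 3
      show ?thesis
      proof (cases "\<exists>s u t. s \<in> T \<inter> W \<and> t \<in> T \<inter> W \<and> u \<in> T \<and> r s < r u \<and> r u < r t \<and> u \<notin> T \<inter> W")
        case False
        then have "T \<inter> W \<in> I ` (T \<times> T)" using 3 by (intro interval) auto
        then show ?thesis by blast
      next
        case True
        then obtain s u t where sut: "s \<in> T \<inter> W" "t \<in> T \<inter> W" "u \<in> T - W" "r s < r u" "r u < r t" by blast
        have "T - W \<in> I ` (T \<times> T)"
        proof (rule interval)
          fix s' u' t'
          assume *: "s' \<in> T - W" "t' \<in> T - W" "u' \<in> T" "r s' < r u'" "r u' < r t'"
          show "u' \<in> T - W"
          proof (rule ccontr)
            assume "u' \<notin> T - W"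
            then show False
              using conv[of "r s" "r u" "r t" "r s'" "r u'" "r t'"] sut * Pr r by auto
          qed
        qed (use 3 in auto)
        then obtain x where "x \<in> T \<times> T" "T - W = I x" by blast
        moreover from this have "T \<inter> W = T - I x" by blast
        ultimately show ?thesis by blast
      qed
    qed
  qed
  then have "{T \<inter> W |W. bond_side W} \<subseteq> I ` (T \<times> T) \<union> (\<lambda>x. T - I x) ` (T \<times> T)" by blast
  then have "card {T \<inter> W |W. bond_side W} \<le> card (I ` (T \<times> T) \<union> (\<lambda>x. T - I x) ` (T \<times> T))"
    using finT by (intro card_mono) auto
  also have "\<dots> \<le> card (I ` (T \<times> T)) + card ((\<lambda>x. T - I x) ` (T \<times> T))" by (rule card_Un_le)
  also have "\<dots> \<le> card (T \<times> T) + card (T \<times> T)"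
    using finT by (intro add_mono card_image_le) auto
  also have "\<dots> = 2 * card T ^ 2" by (simp add: card_cartesian_product power2_eq_square)
  finally show ?thesis .
qed

section \<open>From minimum cuts to bonds, and the product over the faces\<close>

lemma bond_side_if_card_CC:
  assumes W: "W \<subseteq> verts G" "W \<noteq> {}" "W \<noteq> verts G" and card: "card (CC G (cut G W)) = 2"
  shows "bond_side W"
proof -
  define K where "K = (\<lambda>u. {v \<in> verts G. reach_without G (cut G W) u v})"
  have refl: "u \<in> K u" if "u \<in> verts G" for u using that by (auto simp: K_def reach_without_def)
  have side: "u \<in> W \<longleftrightarrow> v \<in> W" if "v \<in> K u" for u v
    using that reach_without_mem_iff[of "cut G W" u v W] by (auto simp: K_def)
  have CC: "CC G (cut G W) = K ` verts G" by (auto simp: CC_def K_def)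
  obtain a where a: "a \<in> W" using W by blast
  obtain b where b: "b \<in> verts G" "b \<notin> W" using W by blast
  \<comment> \<open>No component meets both sides, so \<open>a\<close> and \<open>b\<close> lie in
    different components. By the count there are no others, and each side is a single
    component.\<close>
  have "K a \<noteq> K b" using refl[of b] side[of b a] a b by auto
  moreover have "{K a, K b} \<subseteq> K ` verts G" using a b W by blast
  moreover have "finite (K ` verts G)" using finite_verts by blast
  ultimately have eq: "K ` verts G = {K a, K b}"
    using card CC card_seteq[of "K ` verts G" "{K a, K b}"] by simp
  have Ka: "K u = K a" if "u \<in> W" for u
    using eq that W refl[of u] side[of u b] b by blast
  have Kb: "K u = K b" if "u \<in> verts G" "u \<notin> W" for u
    using eq that W refl[of u] side[of u a] a by blast
  have "reach_without G (cut G W) u v" if "v \<in> verts G" "K u = K v" for u v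
    using refl[of v] that by (auto simp: K_def)
  then show ?thesis unfolding bond_side_def using W Ka Kb by (metis DiffD1 DiffD2 subsetD)
qed

text \<open>Uniqueness makes the description \<open>E_S G S\<close> denote an actual minimum cutset.
  The set \<open>W\<close> defining it may contain the terminals outside \<open>S\<close> instead;
  its complement, with the same cut, then serves.\<close>

lemma T_e_bond_side:
  assumes T: "terms G \<subseteq> verts G" and "unique_min_cuts G" "S \<in> T_e G"
  obtains W where "bond_side W" "S = terms G \<inter> W"
proof -
  have S: "proper_terminal_subset G S" "card (CC G (E_S G S)) = 2" using assms(3) by (auto simp: T_e_def)
  have "is_min_cutset G S (E_S G S)"
    unfolding E_S_def using assms(2) S(1) unfolding unique_min_cuts_def by (metis theI')
  then obtain W where W: "separates G S W" "E_S G S = cut G W" by (auto simp: is_min_cutset_def)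
  have ne: "W \<inter> terms G \<noteq> {}" "W \<inter> terms G \<noteq> terms G"
    using W(1) S(1) unfolding separates_def proper_terminal_subset_def by blast+
  have "bond_side W"
  proof (rule bond_side_if_card_CC)
    show "card (CC G (cut G W)) = 2" using S W by simp
    show "W \<subseteq> verts G" using W(1) by (simp add: separates_def)
  qed (use ne T in auto)
  show thesis
  proof (cases "W \<inter> terms G = S")
    case True
    then show thesis using that[of W] \<open>bond_side W\<close> by blast
  next
    case False
    then have "S = terms G \<inter> (verts G - W)"
      using W S T by (auto simp: separates_def proper_terminal_subset_def)
    then show thesis using that bond_side_Compl[OF \<open>bond_side W\<close>] by blast
  qed
qed

text \<open>\<open>S\<close> is encoded by the tuple of its traces on the parts. The parts cover the
  terminals, so the encoding is injective, and each coordinate is the trace of a bond side on one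
  face.\<close>

lemma card_T_e_le:
  assumes T: "terms G \<subseteq> verts G" and uniq: "unique_min_cuts G"
    and f: "\<And>i. i < m \<Longrightarrow> f i \<in> faces G"
    and Tp: "\<And>i. i < m \<Longrightarrow> Tp i \<subseteq> face_boundary G (f i)" "\<And>i. i < m \<Longrightarrow> Tp i \<noteq> {}"
    and Un: "(\<Union>i<m. Tp i) = terms G"
  shows "card (T_e G) \<le> 2 ^ (2 * m) * (\<Prod>i<m. card (Tp i) ^ 2)"
proof -
  let ?B = "\<lambda>i. {Tp i \<inter> W |W. bond_side W}"
  have finterms: "finite (terms G)"
    using T finite_verts finite_subset by blast
  have finTp: "finite (Tp i)" if "i < m" for i
    using that Un finterms by (auto intro: finite_subset)
  have finB: "finite (?B i)" if "i < m" for i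
    by (rule finite_subset[of _ "Pow (Tp i)"]) (use finTp[OF that] in auto)
  \<comment> \<open>The factor 2 of the trace bound is weakened to 4, so that the product over
    \<open>m\<close> faces yields \<open>2 ^ (2 * m)\<close>.\<close>
  have cardB: "card (?B i) \<le> 4 * card (Tp i) ^ 2" if i: "i < m" for i
  proof -
    have "card (?B i) \<le> 2 * card (Tp i) ^ 2"
      using f[OF i] Tp[OF i] by (rule card_bond_traces)
    then show ?thesis by simp
  qed
  have "inj_on (\<lambda>S. \<lambda>i\<in>{..<m}. Tp i \<inter> S) (T_e G)"
  proof (rule inj_onI)
    fix S S' assume S: "S \<in> T_e G" "S' \<in> T_e G"
      and eq: "(\<lambda>i\<in>{..<m}. Tp i \<inter> S) = (\<lambda>i\<in>{..<m}. Tp i \<inter> S')"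
    have "Tp i \<inter> S = Tp i \<inter> S'" if "i < m" for i
      using fun_cong[OF eq, of i] that by simp
    moreover have "S \<subseteq> (\<Union>i<m. Tp i)" "S' \<subseteq> (\<Union>i<m. Tp i)"
      using S Un by (auto simp: T_e_def proper_terminal_subset_def)
    ultimately show "S = S'" by blast
  qed
  moreover have "(\<lambda>S. \<lambda>i\<in>{..<m}. Tp i \<inter> S) ` T_e G \<subseteq> (\<Pi>\<^sub>E i\<in>{..<m}. ?B i)"
  proof (intro image_subsetI restrict_PiE_iff[THEN iffD2] ballI)
    fix S i assume "S \<in> T_e G" and i: "i \<in> {..<m}"
    then obtain W where W: "bond_side W" "S = terms G \<inter> W"
      using T_e_bond_side[OF T uniq] by blast
    then have "Tp i \<inter> S = Tp i \<inter> W" using i Un by blast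
    then show "Tp i \<inter> S \<in> ?B i" using W by blast
  qed
  ultimately have "card (T_e G) \<le> card (\<Pi>\<^sub>E i\<in>{..<m}. ?B i)"
    using finB by (intro card_inj_on_le) (auto intro: finite_PiE)
  also have "\<dots> = (\<Prod>i<m. card (?B i))" by (simp add: card_PiE)
  also have "\<dots> \<le> (\<Prod>i<m. 4 * card (Tp i) ^ 2)"
    using cardB by (intro prod_mono) auto
  also have "\<dots> = 2 ^ (2 * m) * (\<Prod>i<m. card (Tp i) ^ 2)"
    by (simp add: prod.distrib power_mult)
  finally show ?thesis .
qed

end

section \<open>Minimality of the face cover, the arithmetic-geometric mean, and the final
  bound\<close>

lemma gamma_minimal: "face_cover G m f \<Longrightarrow> gamma G \<le> m"
  unfolding gamma_def by (rule Least_le) blast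

lemma cover_part_nonempty:
  assumes cov: "face_cover G (gamma G) f"
    and Tp: "(\<Union>i<gamma G. Tp i) = terms G" "\<forall>i<gamma G. Tp i \<subseteq> face_boundary G (f i)"
    and i: "i < gamma G"
  shows "Tp i \<noteq> {}"
proof
  assume e: "Tp i = {}"
  define f' where "f' = f(i := f (gamma G - 1))"
  have "face_cover G (gamma G - 1) f'"
    unfolding face_cover_def
  proof (intro conjI allI impI subsetI)
    fix j assume "j < gamma G - 1"
    then show "f' j \<in> faces G" using cov i by (auto simp: f'_def face_cover_def)
  next
    fix t assume "t \<in> terms G"
    then obtain j where j: "j < gamma G" "t \<in> Tp j" using Tp(1) by blast
    then have "j \<noteq> i" "t \<in> face_boundary G (f j)" using e Tp(2) by auto
    then have "t \<in> face_boundary G (f' (if j = gamma G - 1 then i else j))" by (auto simp: f'_def)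
    moreover have "(if j = gamma G - 1 then i else j) < gamma G - 1" using i j \<open>j \<noteq> i\<close> by auto
    ultimately show "t \<in> (\<Union>j<gamma G - 1. face_boundary G (f' j))" by blast
  qed
  then show False using gamma_minimal[of G "gamma G - 1"] i by fastforce
qed

text \<open>The mean inequality raised to the power \<open>m\<close>. It avoids roots and covers
  \<open>m = 0\<close>, where both sides are 1.\<close>

lemma prod_le_mean_power:
  fixes x :: "nat \<Rightarrow> real"
  assumes "\<And>i. i < m \<Longrightarrow> x i \<ge> 0"
  shows "(\<Prod>i<m. x i) \<le> ((\<Sum>i<m. x i) / m) ^ m"
proof (cases "m = 0")
  case False
  have nn: "(\<Prod>i<m. x i) \<ge> 0" using assms by (intro prod_nonneg) auto
  have "(\<Prod>i<m. x i) powr (1 / m) \<le> (\<Sum>i<m. x i) / m"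
    using arith_geom_mean[of "{..<m}" x] assms False by (simp add: sum_divide_distrib lessThan_empty_iff)
  then have "((\<Prod>i<m. x i) powr (1 / m)) ^ m \<le> ((\<Sum>i<m. x i) / m) ^ m"
    by (intro power_mono) auto
  moreover have "((\<Prod>i<m. x i) powr (1 / m)) ^ m = (\<Prod>i<m. x i)"
    using nn False powr_realpow'[of "(\<Prod>i<m. x i) powr (1 / m)" m] by (simp add: powr_powr)
  ultimately show ?thesis by simp
qed simp

theorem theorem4p4:
  fixes G :: "('v, 'd) network" and f :: "nat \<Rightarrow> 'd set" and Tp :: "nat \<Rightarrow> 'v set"
  assumes "terminal_network G"
    and "unique_min_cuts G"
    and "face_cover G (gamma G) f"
    and "\<forall>i<gamma G. \<forall>j<gamma G. i \<noteq> j \<longrightarrow> Tp i \<inter> Tp j = {}"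
    and "(\<Union>i<gamma G. Tp i) = terms G"
    and "\<forall>i<gamma G. Tp i \<subseteq> face_boundary G (f i)"
  shows "real (card (T_e G)) \<le> 2 ^ (2 * gamma G) * (\<Prod>i<gamma G. real (card (Tp i)) ^ 2)
    \<and> 2 ^ (2 * gamma G) * (\<Prod>i<gamma G. real (card (Tp i)) ^ 2)
        \<le> (2 * real (card (terms G)) / real (gamma G)) ^ (2 * gamma G)"
proof
  have pm: "planar_map G"
  proof
    show "comb_map G" "planar_net G" using assms(1) by (auto simp: terminal_network_def planar_net_def)
  qed
  have T: "terms G \<subseteq> verts G" using assms(1) by (simp add: terminal_network_def)
  have "finite (verts G)"
    using assms(1) by (auto simp: terminal_network_def planar_net_def comb_map_def)
  then have finTp: "finite (Tp i)" if "i < gamma G" for i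
    using that T assms(5) by (metis UN_upper finite_subset lessThan_iff)
  have "card (T_e G) \<le> 2 ^ (2 * gamma G) * (\<Prod>i<gamma G. card (Tp i) ^ 2)"
    using assms(3,6) cover_part_nonempty[OF assms(3,5,6)]
    by (intro planar_map.card_T_e_le[OF pm T assms(2) _ _ _ assms(5), of f]) (auto simp: face_cover_def)
  then have "real (card (T_e G)) \<le> real (2 ^ (2 * gamma G) * (\<Prod>i<gamma G. card (Tp i) ^ 2))"
    by (rule of_nat_mono)
  then show "real (card (T_e G)) \<le> 2 ^ (2 * gamma G) * (\<Prod>i<gamma G. real (card (Tp i)) ^ 2)"
    by simp
  \<comment> \<open>Disjointness of the parts makes their sizes add up to exactly the number of
    terminals, so their mean is this number divided by \<open>gamma G\<close>.\<close>
  have "card (terms G) = (\<Sum>i<gamma G. card (Tp i))"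
    unfolding assms(5)[symmetric] using assms(4) finTp by (intro card_UN_disjoint) auto
  then have "(\<Prod>i<gamma G. real (card (Tp i))) \<le> (real (card (terms G)) / gamma G) ^ gamma G"
    using prod_le_mean_power[of "gamma G" "\<lambda>i. real (card (Tp i))"] by simp
  then have "(\<Prod>i<gamma G. real (card (Tp i))) ^ 2 \<le> ((real (card (terms G)) / gamma G) ^ gamma G) ^ 2"
    by (intro power_mono prod_nonneg) auto
  then have "2 ^ (2 * gamma G) * (\<Prod>i<gamma G. real (card (Tp i)) ^ 2)
      \<le> 2 ^ (2 * gamma G) * (real (card (terms G)) / gamma G) ^ (2 * gamma G)"
    by (simp add: prod_power_distrib mult.commute[of 2] power_mult)
  also have "\<dots> = (2 * real (card (terms G)) / real (gamma G)) ^ (2 * gamma G)"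
    by (simp add: power_mult_distrib power_divide)
  finally show "2 ^ (2 * gamma G) * (\<Prod>i<gamma G. real (card (Tp i)) ^ 2)
        \<le> (2 * real (card (terms G)) / real (gamma G)) ^ (2 * gamma G)" .
qed

end
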